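(* Let $f_{\mathrm{cl}}:\mathbb{R}^{n}\to\mathbb{R}^{n}$ be continuous with equilibrium $\xi^*$ (i.e. $f_{\mathrm{cl}}(\xi^* )=\xi^*$), and consider the discrete-time closed-loop system $\xi_{t+1}=f_{\mathrm{cl}}(\xi_t)$. Let $V:\mathbb{R}^{n}\to\mathbb{R}$ be a Lyapunov candidate of one of the two forms given in the context, let $\kappa>0$, let $\mathcal{B}\subset\mathbb{R}^{n}$ be a compact set containing $\xi^*$, let $\rho\in\mathbb{R}$, and put $\mathcal{S}:=\{\xi\in\mathcal{B} : V(\xi)<\rho\}$, where $\rho$ is such that $\xi^*\in\mathcal{S}$. Define $F(\xi):=V(f_{\mathrm{cl}}(\xi))-(1-\kappa)V(\xi)$. If $$\bigl(-F(\xi_t)\ge 0 \ \wedge\ \xi_{t+1}\in\mathcal{B}\bigr)\ \vee\ \bigl(V(\xi_t)\ge\rho\bigr)\qquad\text{for all } \xi_t\in\mathcal{B},$$ where $\xi_{t+1}=f_{\mathrm{cl}}(\xi_t)$, then the closed-loop system $\xi_{t+1}=f_{\mathrm{cl}}(\xi_t)$ is Lyapunov stable (at $\xi^*$) with $\mathcal{S}$ as the certified region-of-attraction.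
   Context: Lyapunov candidates. Fix $\epsilon>0$ and a matrix $R\in\mathbb{R}^{n\times n}$. The function $V$ is either (1) $V(\xi)=|\phi_V(\xi)-\phi_V(\xi^* )|+\|(\epsilon I+R^{T}R)(\xi-\xi^* )\|_1$, where $\phi_V:\mathbb{R}^{n}\to\mathbb{R}$ is a neural network (a continuous function), or (2) $V(\xi)=(\xi-\xi^* )^{T}(\epsilon I+R^{T}R)(\xi-\xi^* )$. Terminology. Lyapunov stability of the system at $\xi^*$ is meant in the usual sense: for every $\varepsilon>0$ there is $\delta>0$ such that every trajectory with $\|\xi_0-\xi^*\|<\delta$ satisfies $\|\xi_t-\xi^*\|<\varepsilon$ for all $t\ge 0$. A set $\mathcal{A}$ is invariant if $f_{\mathrm{cl}}(\mathcal{A})\subseteq\mathcal{A}$. The region-of-attraction $\mathcal{R}$ of $\xi^*$ is the largest invariant set such that, under $\xi_{t+1}=f_{\mathrm{cl}}(\xi_t)$, $\lim_{t\to\infty}\xi_t=\xi^*$ for all $\xi_0\in\mathcal{R}$. That $\mathcal{S}$ is a certified region-of-attraction means that $\mathcal{S}$ is invariant and $\mathcal{S}\subseteq\mathcal{R}$, i.e. $\mathcal{S}$ is an invariant inner approximation of $\mathcal{R}$; in particular every trajectory starting in $\mathcal{S}$ converges to $\xi^*$.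
   Formalization: Lyapunov stability is asserted only when ξ* lies in the interior of B; without this it can fail (f(x)=2x, B={0}, V=εx², ρ=1). That S is a certified region-of-attraction is proved for every compact B containing ξ*. *)

theory Defs
  imports "HOL-Analysis.Analysis"
begin

definition l1_norm :: "real ^ 'n \<Rightarrow> real" where
  "l1_norm x = (\<Sum>i\<in>UNIV. \<bar>x $ i\<bar>)"

definition weight_matrix :: "real \<Rightarrow> real ^ 'n ^ 'n \<Rightarrow> real ^ 'n ^ 'n" where
  "weight_matrix \<epsilon> R = \<epsilon> *\<^sub>R mat 1 + transpose R ** R"

definition nn_candidate ::
  "real \<Rightarrow> real ^ 'n ^ 'n \<Rightarrow> (real ^ 'n \<Rightarrow> real) \<Rightarrow> real ^ 'n \<Rightarrow> real ^ 'n \<Rightarrow> real" where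
  "nn_candidate \<epsilon> R \<phi> \<xi>s \<xi> = \<bar>\<phi> \<xi> - \<phi> \<xi>s\<bar> + l1_norm (weight_matrix \<epsilon> R *v (\<xi> - \<xi>s))"

definition quadratic_candidate ::
  "real \<Rightarrow> real ^ 'n ^ 'n \<Rightarrow> real ^ 'n \<Rightarrow> real ^ 'n \<Rightarrow> real" where
  "quadratic_candidate \<epsilon> R \<xi>s \<xi> = (\<xi> - \<xi>s) \<bullet> (weight_matrix \<epsilon> R *v (\<xi> - \<xi>s))"

text \<open>The network in the first form enters only as a continuous function, so the candidates
  are taken over all continuous \<open>\<phi>\<close>, irrespective of architecture.\<close>

definition lyapunov_candidate ::
  "real \<Rightarrow> real ^ 'n ^ 'n \<Rightarrow> real ^ 'n \<Rightarrow> (real ^ 'n \<Rightarrow> real) \<Rightarrow> bool" where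
  "lyapunov_candidate \<epsilon> R \<xi>s V \<longleftrightarrow>
     (\<exists>\<phi>. continuous_on UNIV \<phi> \<and> V = nn_candidate \<epsilon> R \<phi> \<xi>s) \<or>
     V = quadratic_candidate \<epsilon> R \<xi>s"

definition trajectory :: "('a \<Rightarrow> 'a) \<Rightarrow> (nat \<Rightarrow> 'a) \<Rightarrow> bool" where
  "trajectory f \<xi> \<longleftrightarrow> (\<forall>t. \<xi> (Suc t) = f (\<xi> t))"

definition lyapunov_stable :: "('a::real_normed_vector \<Rightarrow> 'a) \<Rightarrow> 'a \<Rightarrow> bool" where
  "lyapunov_stable f \<xi>s \<longleftrightarrow>
     (\<forall>\<epsilon>>0. \<exists>\<delta>>0. \<forall>\<xi>. trajectory f \<xi> \<and> norm (\<xi> 0 - \<xi>s) < \<delta> \<longrightarrow>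
        (\<forall>t. norm (\<xi> t - \<xi>s) < \<epsilon>))"

definition invariant_set :: "('a \<Rightarrow> 'a) \<Rightarrow> 'a set \<Rightarrow> bool" where
  "invariant_set f A \<longleftrightarrow> f ` A \<subseteq> A"

definition attracted_set :: "('a::topological_space \<Rightarrow> 'a) \<Rightarrow> 'a \<Rightarrow> 'a set \<Rightarrow> bool" where
  "attracted_set f \<xi>s A \<longleftrightarrow> (\<forall>\<xi>. trajectory f \<xi> \<and> \<xi> 0 \<in> A \<longrightarrow> \<xi> \<longlonglongrightarrow> \<xi>s)"

text \<open>The largest invariant set all of whose trajectories converge to \<open>\<xi>s\<close>, obtained as the
  union of all such sets; the lemma below shows that the union is indeed the largest one.\<close>

definition region_of_attraction :: "('a::topological_space \<Rightarrow> 'a) \<Rightarrow> 'a \<Rightarrow> 'a set" where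
  "region_of_attraction f \<xi>s = \<Union>{A. invariant_set f A \<and> attracted_set f \<xi>s A}"

lemma region_of_attraction_greatest:
  shows "invariant_set f (region_of_attraction f \<xi>s)"
    and "attracted_set f \<xi>s (region_of_attraction f \<xi>s)"
    and "invariant_set f A \<Longrightarrow> attracted_set f \<xi>s A \<Longrightarrow> A \<subseteq> region_of_attraction f \<xi>s"
  unfolding region_of_attraction_def invariant_set_def attracted_set_def by blast+

definition certified_region_of_attraction ::
  "('a::topological_space \<Rightarrow> 'a) \<Rightarrow> 'a \<Rightarrow> 'a set \<Rightarrow> bool" where
  "certified_region_of_attraction f \<xi>s S \<longleftrightarrow>
     invariant_set f S \<and> S \<subseteq> region_of_attraction f \<xi>s"

end

theory Submission
  imports Defs
begin

text \<open>Since the weight matrix \<open>W = \<epsilon> I + R\<^sup>T R\<close> satisfies \<open>x\<^sup>T W x \<ge> \<epsilon> \<bar>x\<bar>\<^sup>2\<close> and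
  \<open>\<bar>W x\<bar>\<^sub>1 \<ge> \<epsilon> \<bar>x\<bar>\<close>, small values of \<open>V\<close> on all of \<open>\<real>\<^sup>n\<close> force closeness to \<open>\<xi>\<^sup>*\<close>. On the
  sublevel set \<open>S\<close> the assumption gives \<open>V (f \<xi>) \<le> max 0 (1 - \<kappa>) V \<xi>\<close>, so \<open>V\<close> decays
  geometrically along trajectories.\<close>

lemma inner_weight_matrix_ge:
  "\<epsilon> * (norm x)\<^sup>2 \<le> x \<bullet> (weight_matrix \<epsilon> R *v x)"
proof -
  have "weight_matrix \<epsilon> R *v x = \<epsilon> *\<^sub>R x + transpose R *v (R *v x)"
    by (simp add: weight_matrix_def matrix_vector_mult_add_rdistrib
        scaleR_matrix_vector_assoc[symmetric] matrix_vector_mul_assoc)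
  moreover have "x \<bullet> (transpose R *v (R *v x)) = (R *v x) \<bullet> (R *v x)"
    by (metis dot_lmul_matrix inner_commute vector_transpose_matrix)
  ultimately show ?thesis
    by (simp add: inner_add_right power2_norm_eq_inner)
qed

text \<open>Cauchy-Schwarz bounds the quadratic form above by a product of norms; one factor
  \<open>norm x\<close> then cancels.\<close>

lemma norm_weight_matrix_ge: "\<epsilon> * norm x \<le> norm (weight_matrix \<epsilon> R *v x)"
proof (cases "x = 0")
  case False
  have "\<epsilon> * norm x * norm x \<le> norm (weight_matrix \<epsilon> R *v x) * norm x"
    using inner_weight_matrix_ge[of \<epsilon> x R] norm_cauchy_schwarz[of x "weight_matrix \<epsilon> R *v x"]
    by (simp add: power2_eq_square mult_ac)
  then show ?thesis
    using False by simp
qed simp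

lemma norm_le_l1_norm: "norm x \<le> l1_norm x"
  unfolding l1_norm_def by (rule norm_le_l1_cart)

lemma continuous_on_l1_norm [continuous_intros]:
  "continuous_on A g \<Longrightarrow> continuous_on A (\<lambda>x. l1_norm (g x))"
  unfolding l1_norm_def by (intro continuous_intros)

lemma lyapunov_candidate_continuous:
  assumes "lyapunov_candidate \<epsilon> R \<xi>s V"
  shows "continuous_on UNIV V"
proof -
  have W: "continuous_on UNIV (\<lambda>\<xi>. weight_matrix \<epsilon> R *v (\<xi> - \<xi>s))"
    by (intro linear_continuous_on_compose[OF _ matrix_vector_mul_linear] continuous_intros)
  consider \<phi> where "continuous_on UNIV \<phi>" "V = nn_candidate \<epsilon> R \<phi> \<xi>s"
    | "V = quadratic_candidate \<epsilon> R \<xi>s"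
    using assms unfolding lyapunov_candidate_def by blast
  then show ?thesis
  proof cases
    case 1
    show ?thesis
      unfolding 1(2) nn_candidate_def by (intro continuous_intros 1(1) W)
  next
    case 2
    show ?thesis
      unfolding 2 quadratic_candidate_def by (intro continuous_intros W)
  qed
qed

lemma lyapunov_candidate_center:
  "lyapunov_candidate \<epsilon> R \<xi>s V \<Longrightarrow> V \<xi>s = 0"
  by (auto simp: lyapunov_candidate_def nn_candidate_def quadratic_candidate_def l1_norm_def)

text \<open>The exponent \<open>p\<close> lets both forms be treated alike below: 1 for the network
  form, 2 for the quadratic one.\<close>

lemma lyapunov_candidate_lower_bound:
  assumes "lyapunov_candidate \<epsilon> R \<xi>s V"
  obtains p where "p \<in> {1, 2}" "\<And>\<xi>. \<epsilon> * norm (\<xi> - \<xi>s) ^ p \<le> V \<xi>"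
proof -
  consider \<phi> where "V = nn_candidate \<epsilon> R \<phi> \<xi>s" | "V = quadratic_candidate \<epsilon> R \<xi>s"
    using assms unfolding lyapunov_candidate_def by blast
  then show thesis
  proof cases
    case (1 \<phi>)
    have "\<epsilon> * norm (\<xi> - \<xi>s) \<le> V \<xi>" for \<xi>
      using norm_weight_matrix_ge[of \<epsilon> "\<xi> - \<xi>s" R]
        norm_le_l1_norm[of "weight_matrix \<epsilon> R *v (\<xi> - \<xi>s)"]
      unfolding 1 nn_candidate_def by linarith
    then show thesis
      using that[of 1] by simp
  next
    case 2
    show thesis
      by (rule that[of 2]) (simp_all add: 2 quadratic_candidate_def inner_weight_matrix_ge)
  qed
qed

lemma lyapunov_candidate_nonneg:
  assumes "lyapunov_candidate \<epsilon> R \<xi>s V" "\<epsilon> > 0"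
  shows "V \<xi> \<ge> 0"
  using lyapunov_candidate_lower_bound[OF assms(1)] assms(2)
  by (metis less_imp_le mult_nonneg_nonneg norm_ge_zero order_trans zero_le_power)

text \<open>Turns smallness of \<open>V\<close> into closeness to \<open>\<xi>s\<close>, both for
  convergence and for stability. The threshold \<open>\<epsilon> * e ^ p\<close> is the lower bound
  on \<open>V\<close> evaluated at distance \<open>e\<close>.\<close>

lemma lyapunov_candidate_definite:
  assumes "lyapunov_candidate \<epsilon> R \<xi>s V" "\<epsilon> > 0" "e > 0"
  obtains c where "c > 0" "\<And>\<xi>. V \<xi> < c \<Longrightarrow> norm (\<xi> - \<xi>s) < e"
proof -
  obtain p where p: "\<And>\<xi>. \<epsilon> * norm (\<xi> - \<xi>s) ^ p \<le> V \<xi>"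
    using lyapunov_candidate_lower_bound[OF assms(1)] by blast
  show thesis
  proof
    show "\<epsilon> * e ^ p > 0"
      using assms by simp
    fix \<xi> assume "V \<xi> < \<epsilon> * e ^ p"
    then have "\<epsilon> * norm (\<xi> - \<xi>s) ^ p < \<epsilon> * e ^ p"
      using p[of \<xi>] by simp
    then have "norm (\<xi> - \<xi>s) ^ p < e ^ p"
      using assms(2) by simp
    then show "norm (\<xi> - \<xi>s) < e"
      using assms(3) by (simp add: power_less_imp_less_base)
  qed
qed

lemma trajectory_in_invariant_set:
  assumes "invariant_set f A" "trajectory f \<xi>" "\<xi> 0 \<in> A"
  shows "\<xi> t \<in> A"
  using assms by (induction t) (auto simp: invariant_set_def trajectory_def)

lemma trajectory_geometric_decay:
  fixes V :: "'a \<Rightarrow> real"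
  assumes "invariant_set f A" "trajectory f \<xi>" "\<xi> 0 \<in> A" "q \<ge> 0"
    and decay: "\<And>x. x \<in> A \<Longrightarrow> V (f x) \<le> q * V x"
  shows "V (\<xi> t) \<le> q ^ t * V (\<xi> 0)"
proof (induction t)
  case (Suc t)
  have "V (\<xi> (Suc t)) \<le> q * V (\<xi> t)"
    using decay[OF trajectory_in_invariant_set[OF assms(1-3)]] assms(2)
    by (simp add: trajectory_def)
  also have "\<dots> \<le> q * (q ^ t * V (\<xi> 0))"
    using Suc assms(4) by (rule mult_left_mono)
  finally show ?case
    by simp
qed simp

theorem theorem3p3:
  fixes f :: "real ^ 'n \<Rightarrow> real ^ 'n"
    and \<xi>s :: "real ^ 'n"
    and R :: "real ^ 'n ^ 'n"
    and V F :: "real ^ 'n \<Rightarrow> real"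
    and B S :: "(real ^ 'n) set"
    and \<epsilon> \<kappa> \<rho> :: real
  assumes "continuous_on UNIV f"
    and "f \<xi>s = \<xi>s"
    and "\<epsilon> > 0"
    and "lyapunov_candidate \<epsilon> R \<xi>s V"
    and "\<kappa> > 0"
    and "compact B"
    and "\<xi>s \<in> B"
    and "S = {\<xi> \<in> B. V \<xi> < \<rho>}"
    and "\<xi>s \<in> S"
    and "F = (\<lambda>\<xi>. V (f \<xi>) - (1 - \<kappa>) * V \<xi>)"
    and "\<forall>\<xi>\<in>B. (- F \<xi> \<ge> 0 \<and> f \<xi> \<in> B) \<or> V \<xi> \<ge> \<rho>"
  shows "(\<xi>s \<in> interior B \<longrightarrow> lyapunov_stable f \<xi>s) \<and> certified_region_of_attraction f \<xi>s S"
proof -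
  note cand = \<open>lyapunov_candidate \<epsilon> R \<xi>s V\<close>
  have nonneg: "V \<xi> \<ge> 0" for \<xi>
    using lyapunov_candidate_nonneg[OF cand \<open>\<epsilon> > 0\<close>] .
  have zero: "V \<xi>s = 0"
    using lyapunov_candidate_center[OF cand] .
  have S: "\<xi> \<in> S \<longleftrightarrow> \<xi> \<in> B \<and> V \<xi> < \<rho>" for \<xi>
    using assms(8) by simp
  have "\<rho> > 0"
    using \<open>\<xi>s \<in> S\<close> zero by (simp add: S)
  \<comment> \<open>For \<open>\<kappa> > 1\<close> the factor \<open>1 - \<kappa>\<close> is
    negative, so its powers would not give a monotone bound. Truncating at 0 only weakens the
    estimate, because \<open>V\<close> is nonnegative.\<close>
  define q where "q = max 0 (1 - \<kappa>)"
  have q: "0 \<le> q" "q < 1"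
    using \<open>\<kappa> > 0\<close> by (auto simp: q_def)
  have step: "f \<xi> \<in> B" "V (f \<xi>) \<le> q * V \<xi>" if "\<xi> \<in> S" for \<xi>
  proof -
    from that have "\<xi> \<in> B" "V \<xi> < \<rho>"
      by (auto simp: S)
    \<comment> \<open>\<open>V \<xi> < \<rho>\<close> excludes the second disjunct of the
      assumption.\<close>
    with assms(11) have "F \<xi> \<le> 0" and fB: "f \<xi> \<in> B"
      by auto
    then have "V (f \<xi>) \<le> (1 - \<kappa>) * V \<xi>"
      by (simp add: assms(10))
    also have "\<dots> \<le> q * V \<xi>"
      using nonneg[of \<xi>] by (intro mult_right_mono) (auto simp: q_def)
    finally show "V (f \<xi>) \<le> q * V \<xi>" .
    show "f \<xi> \<in> B"
      by (rule fB)
  qed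
  have inv: "invariant_set f S"
    unfolding invariant_set_def
  proof (rule image_subsetI)
    fix \<xi> assume \<xi>: "\<xi> \<in> S"
    \<comment> \<open>Since \<open>q < 1\<close>, one step cannot raise \<open>V\<close> to the
      level \<open>\<rho>\<close>.\<close>
    have "V (f \<xi>) \<le> V \<xi>"
      using step(2)[OF \<xi>] mult_left_le_one_le[OF nonneg[of \<xi>] q(1)] q(2) by linarith
    then show "f \<xi> \<in> S"
      using \<xi> step(1)[OF \<xi>] by (simp add: S)
  qed
  have bound: "V (\<xi> t) \<le> q ^ t * V (\<xi> 0)" if "trajectory f \<xi>" "\<xi> 0 \<in> S" for \<xi> t
    using trajectory_geometric_decay[OF inv that q(1)] step(2) by blast
  have attr: "attracted_set f \<xi>s S"
    unfolding attracted_set_def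
  proof (intro allI impI)
    fix \<xi> assume \<xi>: "trajectory f \<xi> \<and> \<xi> 0 \<in> S"
    have lim: "(\<lambda>t. q ^ t * V (\<xi> 0)) \<longlonglongrightarrow> 0"
      using q by (intro tendsto_mult_left_zero LIMSEQ_realpow_zero)
    show "\<xi> \<longlonglongrightarrow> \<xi>s"
    proof (rule tendstoI)
      fix e :: real assume "e > 0"
      then obtain c where c: "c > 0" "\<And>x. V x < c \<Longrightarrow> norm (x - \<xi>s) < e"
        using lyapunov_candidate_definite[OF cand \<open>\<epsilon> > 0\<close>] by blast
      have "\<forall>\<^sub>F t in sequentially. q ^ t * V (\<xi> 0) < c"
        using order_tendstoD(2)[OF lim c(1)] .
      then show "\<forall>\<^sub>F t in sequentially. dist (\<xi> t) \<xi>s < e"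
      proof eventually_elim
        case (elim t)
        then show ?case
          using c(2)[of "\<xi> t"] bound[of \<xi> t] \<xi> by (simp add: dist_norm)
      qed
    qed
  qed
  \<comment> \<open>Were \<open>\<xi>s\<close> on the boundary of \<open>B\<close>, trajectories
    could start arbitrarily close to it but outside \<open>B\<close>, where the assumption says
    nothing about \<open>V\<close>. Interiority puts a whole ball around \<open>\<xi>s\<close> into
    \<open>S\<close>.\<close>
  have "lyapunov_stable f \<xi>s" if int: "\<xi>s \<in> interior B"
    unfolding lyapunov_stable_def
  proof (intro allI impI)
    fix e :: real assume "e > 0"
    then obtain c where c: "c > 0" "\<And>x. V x < c \<Longrightarrow> norm (x - \<xi>s) < e"
      using lyapunov_candidate_definite[OF cand \<open>\<epsilon> > 0\<close>] by blast
    have "(V \<longlongrightarrow> 0) (nhds \<xi>s)"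
      using lyapunov_candidate_continuous[OF cand] zero
      by (metis UNIV_I continuous_on_eq_continuous_at isCont_def open_UNIV tendsto_at_iff_tendsto_nhds)
    \<comment> \<open>The bound \<open>\<rho>\<close> yields membership in \<open>S\<close>, hence
      the decay estimate; the bound \<open>c\<close> yields the distance \<open>e\<close>.\<close>
    then have "\<forall>\<^sub>F x in nhds \<xi>s. V x < min c \<rho>"
      using c(1) \<open>\<rho> > 0\<close> by (intro order_tendstoD(2)) auto
    moreover have "\<forall>\<^sub>F x in nhds \<xi>s. x \<in> interior B"
      using int by (intro eventually_nhds_in_open) auto
    ultimately have "\<forall>\<^sub>F x in nhds \<xi>s. x \<in> S \<and> V x < c"
      by eventually_elim (use interior_subset in \<open>auto simp: S\<close>)
    then obtain d where d: "d > 0" "\<And>x. norm (x - \<xi>s) < d \<Longrightarrow> x \<in> S \<and> V x < c"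
      unfolding eventually_nhds_metric dist_norm by blast
    have "norm (\<xi> t - \<xi>s) < e" if "trajectory f \<xi>" "norm (\<xi> 0 - \<xi>s) < d" for \<xi> t
    proof (rule c(2))
      \<comment> \<open>Here only \<open>q ^ t \<le> 1\<close> matters: \<open>V\<close> stays below
        its initial value, so below \<open>c\<close>.\<close>
      have "q ^ t * V (\<xi> 0) \<le> V (\<xi> 0)"
        using q nonneg by (intro mult_left_le_one_le power_le_one) auto
      then show "V (\<xi> t) < c"
        using bound[of \<xi> t] d(2)[OF that(2)] that(1) by linarith
    qed
    with d(1) show "\<exists>\<delta>>0. \<forall>\<xi>. trajectory f \<xi> \<and> norm (\<xi> 0 - \<xi>s) < \<delta> \<longrightarrow>
        (\<forall>t. norm (\<xi> t - \<xi>s) < e)"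
      by blast
  qed
  moreover have "certified_region_of_attraction f \<xi>s S"
    unfolding certified_region_of_attraction_def
    using inv attr region_of_attraction_greatest(3) by blast
  ultimately show ?thesis
    by blast
qed

end
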